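(* Let $x^+\in G(x,v)$ be a stochastic difference inclusion on $\mathcal X\subseteq\mathbb R^n$ with random inputs in $\mathcal V\subseteq\mathbb R^m$, satisfying the standing assumptions (A1)–(A4) and the i.i.d. assumption listed in the context. Let $S\subset\mathcal X$ be a closed set. Then for each $k\in\mathbb N$ and for all $x\in\mathcal X$, the function $(v_0,\dots,v_k)\mapsto\lambda_{k+1}^S(x,v_0,\dots,v_k)$ is measurable.
   Context: Setting. $G:\mathcal X\times\mathcal V\rightrightarrows\mathbb R^n$ is a set-valued map with $G(x,v)\subseteq\mathcal X$. Assumptions on $G$: (A1) for each $v\in\mathcal V$, $x\mapsto G(x,v)$ is upper semicontinuous, meaning that for every $x$ and $\epsilon>0$ there is a neighborhood $U(x)$ with $G(y,v)\subseteq G(x,v)+\epsilon\mathbb B$ for all $y\in U(x)\cap\mathcal X$ ($\mathbb B$ the open unit ball); (A2) $G$ is locally bounded: each point of $\mathcal X\times\mathcal V$ has a neighborhood on which all elements of the values of $G$ are bounded in norm by a common constant; (A3) each $G(x,v)$ is nonempty, closed and convex; (A4) $v\mapsto\operatorname{graph}(G(\cdot,v))=\{(x,y)\in\mathcal X\times\mathcal X: y\in G(x,v)\}$ is a measurable set-valued map (preimages $\{v:\operatorname{graph}(G(\cdot,v))\cap O\ne\emptyset\}$ of open sets $O$ are measurable). I.i.d. assumption: $(v_i)_{i\ge0}$ are i.i.d. random vectors on a probability space $(\Omega,\mathcal F,\mathbb P)$ with values in $\mathcal V$ and common distribution $\mu$ on the Borel sets of $\mathcal V$. Functions $\lambda_k^S:\mathcal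 X\times\mathcal V^k\to\{0,1\}$: with $\mathcal I_S$ the indicator function of $S$, $\lambda_0^S(x)=\mathcal I_S(x)$ and $\lambda_{k+1}^S(x,v_0,\dots,v_k)=\sup_{x_1\in G(x,v_0)}\lambda_k^S(x_1,v_1,\dots,v_k)$. *)

theory Defs
  imports "HOL-Probability.Probability"
begin

text \<open>A set-valued map \<open>X \<times> V \<rightrightarrows> \<real>\<^sup>n\<close> is a total curried function \<open>G\<close>; its values outside
  \<open>X \<times> V\<close> are irrelevant.  Neighbourhoods in \<open>X\<close> and \<open>X \<times> V\<close> are traces of open sets of the
  ambient space.\<close>

definition usc_on ::
  "('a::real_normed_vector) set \<Rightarrow> ('a \<Rightarrow> ('b::real_normed_vector) set) \<Rightarrow> bool" where
  "usc_on X F \<longleftrightarrow>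
     (\<forall>x\<in>X. \<forall>\<epsilon>>0. \<exists>U. open U \<and> x \<in> U \<and>
        (\<forall>y\<in>U \<inter> X. F y \<subseteq> {a + \<epsilon> *\<^sub>R b | a b. a \<in> F x \<and> b \<in> ball 0 1}))"

definition locally_bounded_on ::
  "('a::topological_space) set \<Rightarrow> ('v::topological_space) set
     \<Rightarrow> ('a \<Rightarrow> 'v \<Rightarrow> ('b::real_normed_vector) set) \<Rightarrow> bool" where
  "locally_bounded_on X V G \<longleftrightarrow>
     (\<forall>p\<in>X \<times> V. \<exists>U C. open U \<and> p \<in> U \<and>
        (\<forall>(y, w)\<in>U \<inter> (X \<times> V). \<forall>z\<in>G y w. norm z \<le> C))"

definition graph_on :: "'a set \<Rightarrow> ('a \<Rightarrow> 'a set) \<Rightarrow> ('a \<times> 'a) set" where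
  "graph_on X F = {(x, y) \<in> X \<times> X. y \<in> F x}"

definition measurable_set_valued ::
  "'v measure \<Rightarrow> ('v \<Rightarrow> ('b::topological_space) set) \<Rightarrow> bool" where
  "measurable_set_valued M F \<longleftrightarrow>
     (\<forall>Q. open Q \<longrightarrow> {v \<in> space M. F v \<inter> Q \<noteq> {}} \<in> sets M)"

text \<open>A tuple \<open>(v\<^sub>0, \<dots>, v\<^sub>k\<^sub>-\<^sub>1)\<close> is represented by a function on \<open>nat\<close>, of which
  \<open>hit_val G S k x\<close> reads only the arguments below \<open>k\<close>.  The supremum is taken in \<open>\<real>\<close>; all values
  are 0 or 1 and \<open>G\<close> has nonempty values, so it is a genuine supremum.\<close>

primrec hit_val ::
  "('a \<Rightarrow> 'v \<Rightarrow> 'a set) \<Rightarrow> 'a set \<Rightarrow> nat \<Rightarrow> 'a \<Rightarrow> (nat \<Rightarrow> 'v) \<Rightarrow> real" where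
  "hit_val G S 0 x v = indicator S x"
| "hit_val G S (Suc k) x v = (SUP x1\<in>G x (v 0). hit_val G S k x1 (\<lambda>i. v (Suc i)))"

end

theory Submission
  imports Defs
begin

text \<open>The event that a trajectory from \<open>x\<close> reaches the closed set \<open>S\<close> after \<open>k\<close> steps is the
  intersection over \<open>\<epsilon> = 1/n\<close> of the events that there is an \<open>\<epsilon>\<close>-pseudotrajectory through points
  of a countable dense set \<open>D\<close>.  The latter are measurable by (A4), since only the open boxes
  \<open>ball q \<epsilon> \<times> ball q' \<epsilon>\<close> with \<open>q'\<close> in \<open>D\<close> enter.  Pseudotrajectories with \<open>\<epsilon> \<rightarrow> 0\<close> accumulate at a
  genuine trajectory: local boundedness gives convergent subsequences one step at a time, and upper
  semicontinuity with closed values puts each limit in the value of \<open>G\<close> at the previous one.  Since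
  that limit again lies in \<open>X\<close>, the set \<open>X\<close> need not be closed.\<close>

text \<open>Closed-graph property at \<open>x\<close>: for large \<open>j\<close>,
  \<open>b j\<close> is within \<open>e/2\<close> of some point of \<open>F x\<close> and of
  \<open>y\<close>, so \<open>y\<close> lies in the closure of \<open>F x\<close>.\<close>

lemma usc_on_limit_mem:
  fixes F :: "'a::real_normed_vector \<Rightarrow> 'b::real_normed_vector set"
  assumes usc: "usc_on X F" and "x \<in> X" and cl: "closed (F x)"
    and a: "a \<longlonglongrightarrow> x" "\<And>j. a j \<in> X" and b: "b \<longlonglongrightarrow> y" "\<And>j. b j \<in> F (a j)"
  shows "y \<in> F x"
proof -
  have "\<exists>z\<in>F x. dist z y < e" if e: "e > 0" for e
  proof -
    have "e/2 > 0" using e by simp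
    then obtain U where U: "open U" "x \<in> U" and
      sub: "\<And>y. y \<in> U \<inter> X \<Longrightarrow> F y \<subseteq> {c + (e/2) *\<^sub>R d | c d. c \<in> F x \<and> d \<in> ball 0 1}"
      using usc \<open>x \<in> X\<close> unfolding usc_on_def by meson
    have "\<forall>\<^sub>F j in sequentially. a j \<in> U" using a(1) U by (rule topological_tendstoD)
    moreover have "\<forall>\<^sub>F j in sequentially. dist (b j) y < e/2"
      using b(1) \<open>e/2 > 0\<close> by (rule tendstoD)
    ultimately have "\<forall>\<^sub>F j in sequentially. a j \<in> U \<and> dist (b j) y < e/2"
      by (rule eventually_conj)
    then obtain j where j: "a j \<in> U" "dist (b j) y < e/2"
      using eventually_happens'[OF sequentially_bot] by blast
    then obtain c d where cd: "b j = c + (e/2) *\<^sub>R d" "c \<in> F x" "d \<in> ball 0 1"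
      using sub[of "a j"] a(2)[of j] b(2)[of j] by blast
    have "dist c (b j) = (e/2) * norm d" using cd(1) e by (simp add: dist_norm)
    also have "\<dots> \<le> e/2" using cd(3) e by (simp add: mult_left_le)
    finally have "dist c y < e" using j(2) dist_triangle[of c y "b j"] by linarith
    then show ?thesis using cd(2) by blast
  qed
  then have "y \<in> closure (F x)" by (simp add: closure_approachable)
  then show ?thesis using cl by simp
qed

text \<open>The points \<open>(a j, w)\<close> eventually enter a neighbourhood on which the values
  of \<open>G\<close> are bounded, so a tail of \<open>b\<close> is bounded and Bolzano-Weierstrass
  applies; the closed-graph property places the limit.\<close>

lemma usc_on_locally_bounded_subsequence:
  fixes G :: "'a::real_normed_vector \<Rightarrow> 'v::topological_space \<Rightarrow> 'b::euclidean_space set"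
  assumes usc: "usc_on X (\<lambda>x. G x w)" and lb: "locally_bounded_on X V G"
    and xw: "x \<in> X" "w \<in> V" and cl: "closed (G x w)"
    and a: "a \<longlonglongrightarrow> x" "\<And>j. a j \<in> X" and b: "\<And>j. b j \<in> G (a j) w"
  obtains y and r :: "nat \<Rightarrow> nat" where "y \<in> G x w" "strict_mono r" "(b \<circ> r) \<longlonglongrightarrow> y"
proof -
  have "(x, w) \<in> X \<times> V" using xw by simp
  then obtain U C where U: "open U" "(x, w) \<in> U"
    and C: "\<forall>(y, w')\<in>U \<inter> (X \<times> V). \<forall>z\<in>G y w'. norm z \<le> C"
    using lb unfolding locally_bounded_on_def by meson
  have "(\<lambda>j. (a j, w)) \<longlonglongrightarrow> (x, w)" by (intro tendsto_intros a(1))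
  then have "\<forall>\<^sub>F j in sequentially. (a j, w) \<in> U" using U by (rule topological_tendstoD)
  then obtain N where N: "\<And>j. j \<ge> N \<Longrightarrow> (a j, w) \<in> U"
    unfolding eventually_sequentially by blast
  have "norm (b (j + N)) \<le> C" for j
    using bspec[OF C, of "(a (j + N), w)"] N[of "j + N"] a(2) b xw(2) by simp
  then have "bounded (range (\<lambda>j. b (j + N)))" unfolding bounded_iff by blast
  then obtain y s where s: "strict_mono (s :: nat \<Rightarrow> nat)" "((\<lambda>j. b (j + N)) \<circ> s) \<longlonglongrightarrow> y"
    using bounded_imp_convergent_subsequence by blast
  \<comment> \<open>\<open>s\<close> selects from the tail of \<open>b\<close> starting at
    \<open>N\<close>; adding \<open>N\<close> gives indices into \<open>b\<close> itself.\<close>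
  define r where "r = (\<lambda>j. s j + N)"
  have r: "strict_mono r" using s(1) by (simp add: r_def strict_mono_def)
  have br: "(b \<circ> r) \<longlonglongrightarrow> y" using s(2) by (simp add: r_def o_def)
  have "y \<in> G x w"
  proof (rule usc_on_limit_mem[OF usc xw(1) cl _ _ br])
    show "(a \<circ> r) \<longlonglongrightarrow> x" using a(1) r by (rule LIMSEQ_subseq_LIMSEQ)
  qed (simp_all add: a(2) b)
  then show ?thesis using r br by (rule that)
qed

text \<open>Boolean counterpart of \<open>hit_val\<close>: a supremum of 0/1 values over a nonempty
  set is an existential quantifier.\<close>

primrec hits :: "('a \<Rightarrow> 'v \<Rightarrow> 'a set) \<Rightarrow> 'a set \<Rightarrow> nat \<Rightarrow> 'a \<Rightarrow> (nat \<Rightarrow> 'v) \<Rightarrow> bool" where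
  "hits G S 0 x v \<longleftrightarrow> x \<in> S"
| "hits G S (Suc k) x v \<longleftrightarrow> (\<exists>y\<in>G x (v 0). hits G S k y (\<lambda>i. v (Suc i)))"

lemma cSUP_of_bool:
  assumes "A \<noteq> {}"
  shows "(SUP x\<in>A. of_bool (P x)) = (of_bool (\<exists>x\<in>A. P x) :: real)"
proof (cases "\<exists>x\<in>A. P x")
  case True
  then show ?thesis by (auto intro!: cSup_eq_maximum)
next
  case False
  then have "(\<lambda>x. of_bool (P x) :: real) ` A = {0}" using assms by auto
  then show ?thesis using False by simp
qed

lemma hit_val_eq_of_bool:
  assumes "\<And>x w. x \<in> X \<Longrightarrow> w \<in> V \<Longrightarrow> G x w \<subseteq> X \<and> G x w \<noteq> {}"
    and "x \<in> X" "\<And>i. i < k \<Longrightarrow> v i \<in> V"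
  shows "hit_val G S k x v = of_bool (hits G S k x v)"
  using assms(2,3)
proof (induction k arbitrary: x v)
  case 0
  then show ?case by (simp add: indicator_def)
next
  case (Suc k)
  \<comment> \<open>The inclusion lets the induction hypothesis apply to every successor;
    nonemptiness excludes a supremum over the empty set.\<close>
  have G: "G x (v 0) \<subseteq> X" "G x (v 0) \<noteq> {}" using assms(1) Suc.prems by auto
  have "hit_val G S k y (\<lambda>i. v (Suc i)) = of_bool (hits G S k y (\<lambda>i. v (Suc i)))"
    if "y \<in> G x (v 0)" for y
    using that G Suc.prems by (intro Suc.IH) auto
  then show ?case using G by (simp add: cSUP_of_bool cong: SUP_cong)
qed

text \<open>Consecutive graph points need not join up: the end of one step and the start of the next
  are only both within \<epsilon> of the waypoint \<open>q'\<close>. This slack allows waypoints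
  from a countable set.\<close>

primrec pseudo_hit ::
  "'a::metric_space set \<Rightarrow> 'a set \<Rightarrow> ('a \<Rightarrow> 'v \<Rightarrow> 'a set) \<Rightarrow> 'a set \<Rightarrow> real
     \<Rightarrow> nat \<Rightarrow> 'a \<Rightarrow> (nat \<Rightarrow> 'v) \<Rightarrow> bool" where
  "pseudo_hit D X G S \<epsilon> 0 q v \<longleftrightarrow> (\<exists>s\<in>S. dist q s < \<epsilon>)"
| "pseudo_hit D X G S \<epsilon> (Suc k) q v \<longleftrightarrow>
     (\<exists>q'\<in>D. graph_on X (\<lambda>x. G x (v 0)) \<inter> (ball q \<epsilon> \<times> ball q' \<epsilon>) \<noteq> {} \<and>
        pseudo_hit D X G S \<epsilon> k q' (\<lambda>i. v (Suc i)))"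

lemma measurable_shift_PiM:
  "(\<lambda>v i. v (Suc i)) \<in> measurable (PiM {..<Suc k} (\<lambda>_. M)) (PiM {..<k} (\<lambda>_. M))"
proof (rule measurable_PiM_single')
  show "(\<lambda>v i. v (Suc i)) \<in> space (PiM {..<Suc k} (\<lambda>_. M)) \<rightarrow> {..<k} \<rightarrow>\<^sub>E space M"
    by (auto simp: space_PiM PiE_def extensional_def)
qed (auto intro: measurable_component_singleton)

text \<open>Sorting by the first waypoint gives a countable union of events, each a condition on
  \<open>v 0\<close> (the graph meets an open box) intersected with the preimage under the shift of
  an event with one step fewer.\<close>

lemma sets_pseudo_hit:
  fixes G :: "'a::metric_space \<Rightarrow> 'v \<Rightarrow> 'a set"
  assumes meas: "measurable_set_valued M (\<lambda>v. graph_on X (\<lambda>x. G x v))" and D: "countable D"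
  shows "{v \<in> space (PiM {..<k} (\<lambda>_. M)). pseudo_hit D X G S \<epsilon> k q v} \<in> sets (PiM {..<k} (\<lambda>_. M))"
proof (induction k arbitrary: q)
  \<comment> \<open>The condition does not involve \<open>v\<close>, so the event is empty or the
    whole space.\<close>
  case 0
  then show ?case by simp
next
  case (Suc k)
  let ?N = "PiM {..<Suc k} (\<lambda>_. M)"
  define E where "E q' = {w \<in> space M. graph_on X (\<lambda>x. G x w) \<inter> (ball q \<epsilon> \<times> ball q' \<epsilon>) \<noteq> {}}" for q'
  have "E q' \<in> sets M" for q'
    using meas unfolding measurable_set_valued_def E_def by (simp add: open_Times)
  then have 1: "(\<lambda>v. v 0) -` E q' \<inter> space ?N \<in> sets ?N" for q'
    by (intro measurable_sets[OF measurable_component_singleton]) auto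
  have 2: "(\<lambda>v i. v (Suc i)) -` {v \<in> space (PiM {..<k} (\<lambda>_. M)). pseudo_hit D X G S \<epsilon> k q' v}
      \<inter> space ?N \<in> sets ?N" for q'
    by (rule measurable_sets[OF measurable_shift_PiM Suc.IH])
  have sp: "v 0 \<in> space M" "(\<lambda>i. v (Suc i)) \<in> space (PiM {..<k} (\<lambda>_. M))"
    if "v \<in> space ?N" for v
    using measurable_space[OF measurable_shift_PiM that]
      measurable_space[OF measurable_component_singleton[of 0 "{..<Suc k}" "\<lambda>_. M"] that]
    by simp_all
  have "{v \<in> space ?N. pseudo_hit D X G S \<epsilon> (Suc k) q v} =
      (\<Union>q'\<in>D. ((\<lambda>v. v 0) -` E q' \<inter> space ?N) \<inter>
        ((\<lambda>v i. v (Suc i)) -` {v \<in> space (PiM {..<k} (\<lambda>_. M)). pseudo_hit D X G S \<epsilon> k q' v}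
          \<inter> space ?N))"
    using sp unfolding E_def pseudo_hit.simps by blast
  also have "\<dots> \<in> sets ?N" using D 1 2 by (blast intro: sets.countable_UN'' sets.Int)
  finally show ?case .
qed

text \<open>Round each point of a genuine trajectory to a point of \<open>D\<close> within
  \<epsilon>. The start \<open>q\<close> is only near \<open>x\<close>, so that the induction can
  continue from a rounded point.\<close>

lemma hits_imp_pseudo_hit:
  fixes G :: "'a::metric_space \<Rightarrow> 'v \<Rightarrow> 'a set"
  assumes sub: "\<And>x w. x \<in> X \<Longrightarrow> w \<in> V \<Longrightarrow> G x w \<subseteq> X"
    and D: "\<And>U. open U \<Longrightarrow> U \<noteq> {} \<Longrightarrow> \<exists>d\<in>D. d \<in> U" and "\<epsilon> > 0"
    and "x \<in> X" "\<And>i. i < k \<Longrightarrow> v i \<in> V" "hits G S k x v" "dist q x < \<epsilon>"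
  shows "pseudo_hit D X G S \<epsilon> k q v"
  using assms(4-)
proof (induction k arbitrary: x v q)
  case 0
  then show ?case by auto
next
  case (Suc k)
  then obtain y where y: "y \<in> G x (v 0)" "hits G S k y (\<lambda>i. v (Suc i))" by auto
  have "y \<in> X" using y(1) sub Suc.prems by blast
  obtain q' where q': "q' \<in> D" "dist q' y < \<epsilon>"
    using D[of "ball y \<epsilon>"] \<open>\<epsilon> > 0\<close> by (auto simp: dist_commute)
  have "pseudo_hit D X G S \<epsilon> k q' (\<lambda>i. v (Suc i))"
    using \<open>y \<in> X\<close> Suc.prems y(2) q'(2) by (intro Suc.IH) auto
  moreover have "(x, y) \<in> graph_on X (\<lambda>x. G x (v 0)) \<inter> (ball q \<epsilon> \<times> ball q' \<epsilon>)"
    using Suc.prems \<open>y \<in> X\<close> y(1) q'(2) by (simp add: graph_on_def)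
  ultimately show ?case using q'(1) unfolding pseudo_hit.simps by blast
qed

lemma tendsto_of_dist_less:
  fixes f g :: "nat \<Rightarrow> 'a::real_normed_vector"
  assumes "f \<longlonglongrightarrow> l" "\<epsilon> \<longlonglongrightarrow> 0" "\<And>j. dist (f j) (g j) < \<epsilon> j"
  shows "g \<longlonglongrightarrow> l"
proof (rule Lim_transform[OF assms(1)])
  have "(\<lambda>j. dist (f j) (g j)) \<longlonglongrightarrow> 0"
    by (rule tendsto_sandwich[OF _ _ tendsto_const assms(2)])
      (auto intro: always_eventually less_imp_le assms(3))
  then show "(\<lambda>j. g j - f j) \<longlonglongrightarrow> 0"
    by (subst tendsto_norm_zero_iff[symmetric]) (simp add: dist_norm norm_minus_commute)
qed

text \<open>The start \<open>q\<close> and the tolerance \<epsilon> are arbitrary sequences, since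
  after one step the waypoints are known to converge only along a subsequence, to which the
  induction hypothesis is then applied.\<close>

lemma hits_of_pseudo_hit:
  fixes G :: "'a::euclidean_space \<Rightarrow> 'v::topological_space \<Rightarrow> 'a set"
  assumes sub: "\<And>x w. x \<in> X \<Longrightarrow> w \<in> V \<Longrightarrow> G x w \<subseteq> X"
    and usc: "\<And>w. w \<in> V \<Longrightarrow> usc_on X (\<lambda>x. G x w)" and lb: "locally_bounded_on X V G"
    and cl: "\<And>x w. x \<in> X \<Longrightarrow> w \<in> V \<Longrightarrow> closed (G x w)" and S: "closed S"
    and "x \<in> X" "\<And>i. i < k \<Longrightarrow> v i \<in> V" "q \<longlonglongrightarrow> x" "\<epsilon> \<longlonglongrightarrow> 0"
    and "\<And>j. pseudo_hit D X G S (\<epsilon> j) k (q j) v"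
  shows "hits G S k x v"
  using assms(6-)
proof (induction k arbitrary: x v q \<epsilon>)
  case 0
  then obtain s where s: "\<And>j. s j \<in> S" "\<And>j. dist (q j) (s j) < \<epsilon> j" by (simp add: Bex_def) metis
  have "s \<longlonglongrightarrow> x" using "0.prems"(3,4) s(2) by (rule tendsto_of_dist_less)
  then show ?case using closed_sequentially[OF S, of s] s(1) by simp
next
  case (Suc k)
  have v0: "v 0 \<in> V" using Suc.prems(2) by simp
  have "\<exists>a b q'. (a, b) \<in> graph_on X (\<lambda>x. G x (v 0)) \<and> dist (q j) a < \<epsilon> j \<and> dist q' b < \<epsilon> j \<and>
      pseudo_hit D X G S (\<epsilon> j) k q' (\<lambda>i. v (Suc i))" for j
    using Suc.prems(5)[of j] by fastforce
  then obtain a b q' where "\<And>j. (a j, b j) \<in> graph_on X (\<lambda>x. G x (v 0))"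
    and qa: "\<And>j. dist (q j) (a j) < \<epsilon> j" and qb: "\<And>j. dist (q' j) (b j) < \<epsilon> j"
    and ph: "\<And>j. pseudo_hit D X G S (\<epsilon> j) k (q' j) (\<lambda>i. v (Suc i))"
    by metis
  then have ab: "\<And>j. a j \<in> X" "\<And>j. b j \<in> G (a j) (v 0)" by (auto simp: graph_on_def)
  have "a \<longlonglongrightarrow> x" using Suc.prems(3,4) qa by (rule tendsto_of_dist_less)
  then obtain y r where y: "y \<in> G x (v 0)" and r: "strict_mono r" "(b \<circ> r) \<longlonglongrightarrow> y"
    using usc_on_locally_bounded_subsequence[OF usc[OF v0] lb Suc.prems(1) v0 cl[OF Suc.prems(1) v0]] ab
    by metis
  have "(\<epsilon> \<circ> r) \<longlonglongrightarrow> 0" using Suc.prems(4) r(1) by (rule LIMSEQ_subseq_LIMSEQ)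
  \<comment> \<open>The waypoints follow \<open>b\<close> within the vanishing tolerance, so they
    share its limit along \<open>r\<close>.\<close>
  moreover have "(q' \<circ> r) \<longlonglongrightarrow> y"
    using r(2) \<open>(\<epsilon> \<circ> r) \<longlonglongrightarrow> 0\<close> by (rule tendsto_of_dist_less) (simp add: qb dist_commute[of "b _"])
  moreover have "y \<in> X" using y sub Suc.prems(1) v0 by blast
  ultimately have "hits G S k y (\<lambda>i. v (Suc i))"
    using Suc.prems(2) ph by (intro Suc.IH[of y _ "q' \<circ> r" "\<epsilon> \<circ> r"]) (simp_all add: o_def)
  then show ?case using y by auto
qed

theorem lemma12:
  fixes X :: "(real ^ 'n) set"
    and V :: "(real ^ 'm) set"
    and G :: "real ^ 'n \<Rightarrow> real ^ 'm \<Rightarrow> (real ^ 'n) set"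
    and S :: "(real ^ 'n) set"
    and P :: "'w measure"
    and \<nu> :: "nat \<Rightarrow> 'w \<Rightarrow> real ^ 'm"
    and \<mu> :: "(real ^ 'm) measure"
  assumes G_sub: "\<And>x v. x \<in> X \<Longrightarrow> v \<in> V \<Longrightarrow> G x v \<subseteq> X"
    and A1: "\<And>v. v \<in> V \<Longrightarrow> usc_on X (\<lambda>x. G x v)"
    and A2: "locally_bounded_on X V G"
    and A3: "\<And>x v. x \<in> X \<Longrightarrow> v \<in> V \<Longrightarrow> G x v \<noteq> {} \<and> closed (G x v) \<and> convex (G x v)"
    and A4: "measurable_set_valued (restrict_space borel V) (\<lambda>v. graph_on X (\<lambda>x. G x v))"
    and prob: "prob_space P"
    and indep: "prob_space.indep_vars P (\<lambda>_. restrict_space borel V) \<nu> UNIV"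
    and distr: "\<And>i. distr P (restrict_space borel V) (\<nu> i) = \<mu>"
    and S: "closed S" "S \<subseteq> X"
  shows "\<forall>k::nat. \<forall>x\<in>X.
    (\<lambda>v. hit_val G S (Suc k) x v)
      \<in> borel_measurable (PiM {..k} (\<lambda>_. restrict_space borel V))"
proof (intro allI ballI)
  fix k :: nat and x assume x: "x \<in> X"
  let ?M = "restrict_space borel V :: (real ^ 'm) measure"
  \<comment> \<open>Indexing by \<open>{..<Suc k}\<close> matches the recursion on the number of
    steps; it equals \<open>{..k}\<close>.\<close>
  let ?N = "PiM {..<Suc k} (\<lambda>_. ?M)"
  obtain D :: "(real ^ 'n) set" where D: "countable D" "\<And>U. open U \<Longrightarrow> U \<noteq> {} \<Longrightarrow> \<exists>d\<in>D. d \<in> U"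
    using countable_dense_exists by blast
  have V: "v i \<in> V" if "v \<in> space ?N" "i < Suc k" for v i
    using that by (auto simp: space_PiM PiE_def Pi_def space_restrict_space)
  have "hits G S (Suc k) x v \<longleftrightarrow> (\<forall>n. pseudo_hit D X G S (1 / real (Suc n)) (Suc k) x v)"
    if v: "v \<in> space ?N" for v
  proof
    assume "hits G S (Suc k) x v"
    then show "\<forall>n. pseudo_hit D X G S (1 / real (Suc n)) (Suc k) x v"
      using hits_imp_pseudo_hit[of X V G D _ x "Suc k" v S x] G_sub D(2) x V[OF v]
      by (simp del: hits.simps pseudo_hit.simps)
  next
    assume *: "\<forall>n. pseudo_hit D X G S (1 / real (Suc n)) (Suc k) x v"
    show "hits G S (Suc k) x v"
      \<comment> \<open>All pseudotrajectories start exactly at \<open>x\<close>, hence the constant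
        sequence.\<close>
      by (rule hits_of_pseudo_hit[where D = D and q = "\<lambda>_. x" and \<epsilon> = "\<lambda>n. 1 / real (Suc n)"])
        (use G_sub A1 A2 A3 S(1) x V[OF v] * LIMSEQ_Suc[OF lim_1_over_n] in auto)
  qed
  then have "{v \<in> space ?N. hits G S (Suc k) x v} =
      {v \<in> space ?N. \<forall>n. pseudo_hit D X G S (1 / real (Suc n)) (Suc k) x v}" by blast
  also have "\<dots> \<in> sets ?N"
    by (intro sets.sets_Collect_countable_All sets_pseudo_hit A4 D(1))
  finally have "(indicator {v \<in> space ?N. hits G S (Suc k) x v} :: _ \<Rightarrow> real) \<in> borel_measurable ?N"
    by (rule borel_measurable_indicator)
  \<comment> \<open>On the product space, \<open>hit_val\<close> is the indicator of the event just
    shown to be measurable.\<close>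
  also have "?this \<longleftrightarrow> (\<lambda>v. hit_val G S (Suc k) x v) \<in> borel_measurable ?N"
  proof (rule measurable_cong)
    fix v assume v: "v \<in> space ?N"
    then have "hit_val G S (Suc k) x v = of_bool (hits G S (Suc k) x v)"
      using G_sub A3 x V by (intro hit_val_eq_of_bool[of X V]) simp_all
    then show "indicator {v \<in> space ?N. hits G S (Suc k) x v} v = hit_val G S (Suc k) x v"
      using v by (simp del: hits.simps hit_val.simps)
  qed
  finally show "(\<lambda>v. hit_val G S (Suc k) x v) \<in> borel_measurable (PiM {..k} (\<lambda>_. ?M))"
    by (simp only: lessThan_Suc_atMost)
qed

end
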